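(* Let $X$ be a Banach space, $T: X \to X$ and $K:(0,\infty) \to [0,1)$, such that $T$ is a contraction for large distances with modulus $K$. Then $T$ is super strongly nonexpansive with modulus $$\chi(\varepsilon):= \left(1-\left(K\left(\frac\varepsilon2\right)\right)^2\right)\left(\frac\varepsilon2\right)^2.$$
   Context: $T:X\to X$ is a contraction for large distances with modulus $K:(0,\infty)\to[0,1)$ if for all $\varepsilon>0$ and $x,y\in X$ with $\|x-y\|\ge\varepsilon$, $\|Tx-Ty\|\le K(\varepsilon)\|x-y\|$. $T$ is super strongly nonexpansive with modulus $\chi:(0,\infty)\to(0,\infty)$ if $\chi$ is an SSNE-modulus for $T$: for any $\varepsilon>0$ and $x,y\in X$ with $\|x-y\|^2-\|Tx-Ty\|^2<\chi(\varepsilon)$, we have $\|(x-y)-(Tx-Ty)\|<\varepsilon$. (Existence of such a $\chi$ is equivalent to $T$ being super strongly nonexpansive: $T$ is nonexpansive, i.e. $\|Tx-Ty\|\le\|x-y\|$ for all $x,y\in X$, and, whenever $(x_n),(y_n)\subseteq X$ with $\|x_n-y_n\|^2-\|Tx_n-Ty_n\|^2\to0$, then $(x_n-y_n)-(Tx_n-Ty_n)\to0$.) *)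

theory Defs
  imports Complex_Main "HOL-Library.FuncSet"
begin

(* Moduli are total functions on real, of which only the values on (0,\<infinity>) matter. *)

definition contraction_for_large_distances_with_modulus ::
    "('a::real_normed_vector \<Rightarrow> 'a) \<Rightarrow> (real \<Rightarrow> real) \<Rightarrow> bool" where
  "contraction_for_large_distances_with_modulus T K \<longleftrightarrow>
     K \<in> {0<..} \<rightarrow> {0..<1} \<and>
     (\<forall>\<epsilon>>0. \<forall>x y. norm (x - y) \<ge> \<epsilon> \<longrightarrow> norm (T x - T y) \<le> K \<epsilon> * norm (x - y))"

definition super_strongly_nonexpansive_with_modulus ::
    "('a::real_normed_vector \<Rightarrow> 'a) \<Rightarrow> (real \<Rightarrow> real) \<Rightarrow> bool" where
  "super_strongly_nonexpansive_with_modulus T \<chi> \<longleftrightarrow>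
     \<chi> \<in> {0<..} \<rightarrow> {0<..} \<and>
     (\<forall>\<epsilon>>0. \<forall>x y. (norm (x - y))\<^sup>2 - (norm (T x - T y))\<^sup>2 < \<chi> \<epsilon>
        \<longrightarrow> norm ((x - y) - (T x - T y)) < \<epsilon>)"

end

theory Submission
  imports Defs
begin

text \<open>If \<open>x\<close> and \<open>y\<close> are at distance at least
  \<open>\<epsilon> / 2\<close>, contraction at that scale makes the difference of squared norms at
  least \<open>\<chi> \<epsilon>\<close>. A smaller difference thus forces
  \<open>norm (x - y) < \<epsilon> / 2\<close>. By nonexpansiveness \<open>T x - T y\<close> is just
  as short, and the triangle inequality bounds the difference of the two vectors by
  \<open>\<epsilon>\<close>.\<close>

lemma contraction_for_large_distances_nonexpansive:
  fixes T :: "'a::real_normed_vector \<Rightarrow> 'a"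
  assumes "contraction_for_large_distances_with_modulus T K"
  shows "norm (T x - T y) \<le> norm (x - y)"
proof (cases "x = y")
  case False
  \<comment> \<open>The distance itself serves as the threshold, so the contraction estimate applies
    to every pair of distinct points.\<close>
  define d where "d = norm (x - y)"
  have d: "d > 0" using False by (simp add: d_def)
  then have "K d < 1" and "norm (T x - T y) \<le> K d * d"
    using assms by (auto simp: contraction_for_large_distances_with_modulus_def d_def)
  moreover have "K d * d \<le> 1 * d"
    using d \<open>K d < 1\<close> by (intro mult_right_mono) auto
  ultimately show ?thesis by (simp add: d_def)
qed simp

theorem proposition2p14:
  fixes T :: "'a::banach \<Rightarrow> 'a" and K :: "real \<Rightarrow> real"
  assumes "contraction_for_large_distances_with_modulus T K"
  shows "super_strongly_nonexpansive_with_modulus T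
           (\<lambda>\<epsilon>. (1 - (K (\<epsilon> / 2))\<^sup>2) * (\<epsilon> / 2)\<^sup>2)"
proof -
  \<comment> \<open>Needed twice: for the positivity of the modulus, and as the nonnegative factor
    when \<open>\<epsilon> / 2\<close> is replaced by \<open>norm (x - y)\<close>.\<close>
  have K: "1 - (K \<delta>)\<^sup>2 > 0" if "\<delta> > 0" for \<delta>
  proof -
    have "K \<delta> \<in> {0..<1}"
      using assms that by (auto simp: contraction_for_large_distances_with_modulus_def)
    then show ?thesis
      by (simp add: abs_square_less_1)
  qed
  have "norm ((x - y) - (T x - T y)) < \<epsilon>"
    if \<epsilon>: "\<epsilon> > 0"
      and less: "(norm (x - y))\<^sup>2 - (norm (T x - T y))\<^sup>2 < (1 - (K (\<epsilon> / 2))\<^sup>2) * (\<epsilon> / 2)\<^sup>2"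
    for \<epsilon> x y
  proof -
    have "norm (x - y) < \<epsilon> / 2"
    proof (rule ccontr)
      assume "\<not> norm (x - y) < \<epsilon> / 2"
      then have ge: "norm (x - y) \<ge> \<epsilon> / 2" by simp
      then have "norm (T x - T y) \<le> K (\<epsilon> / 2) * norm (x - y)"
        using assms \<epsilon> by (simp add: contraction_for_large_distances_with_modulus_def)
      then have "(norm (T x - T y))\<^sup>2 \<le> (K (\<epsilon> / 2))\<^sup>2 * (norm (x - y))\<^sup>2"
        by (metis norm_ge_zero power_mono power_mult_distrib)
      moreover have "(1 - (K (\<epsilon> / 2))\<^sup>2) * (\<epsilon> / 2)\<^sup>2 \<le> (1 - (K (\<epsilon> / 2))\<^sup>2) * (norm (x - y))\<^sup>2"
        using ge \<epsilon> K[of "\<epsilon> / 2"] by (intro mult_left_mono power_mono) auto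
      \<comment> \<open>Together the two bounds make the difference of squares at least
        \<open>(1 - (K (\<epsilon> / 2))\<^sup>2) * (norm (x - y))\<^sup>2\<close>, hence at least
        the modulus, against \<open>less\<close>.\<close>
      ultimately show False
        using less by (simp add: left_diff_distrib)
    qed
    moreover have "norm (T x - T y) \<le> norm (x - y)"
      using assms by (rule contraction_for_large_distances_nonexpansive)
    \<comment> \<open>Each of the two vectors contributes less than \<open>\<epsilon> / 2\<close>,
      which is why the modulus uses half of \<open>\<epsilon>\<close>.\<close>
    ultimately show ?thesis
      using norm_triangle_ineq4[of "x - y" "T x - T y"] by simp
  qed
  then show ?thesis
    using K by (auto simp: super_strongly_nonexpansive_with_modulus_def)
qed

end
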